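(* Let $n\geq 3$ and $m\geq 2$ be integers, and let $T_n$ be a tree with $n$ vertices. Then $$R(T_n,2K_m)=(n-1)(m-1)+2.$$
   Context: All graphs are finite, undirected and simple. $K_m$ is the complete graph on $m$ vertices and $2K_m$ is the disjoint union of two copies of $K_m$. For graphs $G,H$, the Ramsey number $R(G,H)$ is the minimum integer $N$ such that any coloring of the edges of $K_N$ in red or blue yields a red copy of $G$ or a blue copy of $H$ (as a not necessarily induced subgraph). *)

theory Defs
  imports Main "HOL-Library.Ramsey"
begin

text \<open>
  Undirected simple graphs: edges are two-element sets of vertices, so loops and parallel
  edges are excluded by \<open>simple_graph\<close>.
\<close>

record 'a ugraph =
  verts :: "'a set"
  edges :: "'a set set"

definition simple_graph :: "'a ugraph \<Rightarrow> bool" where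
  "simple_graph G \<longleftrightarrow> finite (verts G) \<and> edges G \<subseteq> [verts G]\<^bsup>2\<^esup>"

definition complete_graph :: "nat \<Rightarrow> nat ugraph" where
  "complete_graph m = \<lparr>verts = {..<m}, edges = [{..<m}]\<^bsup>2\<^esup>\<rparr>"

definition disjoint_union :: "'a ugraph \<Rightarrow> 'b ugraph \<Rightarrow> ('a + 'b) ugraph" where
  "disjoint_union G H =
    \<lparr>verts = verts G <+> verts H,
     edges = (image Inl) ` edges G \<union> (image Inr) ` edges H\<rparr>"

definition walk :: "'a ugraph \<Rightarrow> 'a list \<Rightarrow> bool" where
  "walk G p \<longleftrightarrow> p \<noteq> [] \<and> set p \<subseteq> verts G \<and> successively (\<lambda>u v. {u, v} \<in> edges G) p"

definition connected_graph :: "'a ugraph \<Rightarrow> bool" where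
  "connected_graph G \<longleftrightarrow> verts G \<noteq> {} \<and>
    (\<forall>u\<in>verts G. \<forall>v\<in>verts G. \<exists>p. walk G p \<and> hd p = u \<and> last p = v)"

text \<open>A cycle is given by its vertices in cyclic order, the first one not being repeated.\<close>

definition cycle :: "'a ugraph \<Rightarrow> 'a list \<Rightarrow> bool" where
  "cycle G p \<longleftrightarrow> walk G p \<and> distinct p \<and> length p \<ge> 3 \<and> {last p, hd p} \<in> edges G"

definition tree :: "'a ugraph \<Rightarrow> bool" where
  "tree G \<longleftrightarrow> simple_graph G \<and> connected_graph G \<and> (\<nexists>p. cycle G p)"

text \<open>\<open>contains_copy G H\<close>: some not necessarily induced subgraph of \<open>G\<close> is isomorphic to \<open>H\<close>.\<close>

definition contains_copy :: "'a ugraph \<Rightarrow> 'b ugraph \<Rightarrow> bool" where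
  "contains_copy G H \<longleftrightarrow>
    (\<exists>f. inj_on f (verts H) \<and> f ` verts H \<subseteq> verts G \<and> (\<forall>e\<in>edges H. f ` e \<in> edges G))"

datatype colour = Red | Blue

text \<open>A colouring is total on sets of vertices, but only its values on edges are ever used.\<close>

definition colour_subgraph :: "'a ugraph \<Rightarrow> ('a set \<Rightarrow> colour) \<Rightarrow> colour \<Rightarrow> 'a ugraph" where
  "colour_subgraph G c k = \<lparr>verts = verts G, edges = {e \<in> edges G. c e = k}\<rparr>"

definition ramsey_arrows :: "nat \<Rightarrow> 'a ugraph \<Rightarrow> 'b ugraph \<Rightarrow> bool" where
  "ramsey_arrows N G H \<longleftrightarrow>
    (\<forall>c. contains_copy (colour_subgraph (complete_graph N) c Red) G \<or>
         contains_copy (colour_subgraph (complete_graph N) c Blue) H)"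

definition ramsey_number :: "'a ugraph \<Rightarrow> 'b ugraph \<Rightarrow> nat" where
  "ramsey_number G H = (LEAST N. ramsey_arrows N G H)"

text \<open>For finite graphs the minimum is attained, by Ramsey's theorem for cliques.\<close>

lemma contains_copy_of_clique:
  assumes "simple_graph G" and X: "X \<in> [{..<N}]\<^bsup>card (verts G)\<^esup>"
    and mono: "\<And>e. e \<in> [X]\<^bsup>2\<^esup> \<Longrightarrow> c e = k"
  shows "contains_copy (colour_subgraph (complete_graph N) c k) G"
proof -
  have fin: "finite (verts G)" and E: "edges G \<subseteq> [verts G]\<^bsup>2\<^esup>"
    using assms(1) by (auto simp: simple_graph_def)
  have X': "X \<subseteq> {..<N}" "finite X" "card X = card (verts G)"
    using X by (auto simp: nsets_def)
  obtain f where f: "bij_betw f (verts G) X"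
    using finite_same_card_bij[OF fin X'(2)] X'(3) by auto
  have edge: "f ` e \<in> [X]\<^bsup>2\<^esup>" if "e \<in> edges G" for e
  proof -
    have e: "e \<subseteq> verts G" "finite e" "card e = 2" using that E by (auto simp: nsets_def)
    have "card (f ` e) = 2"
      using card_image[of f e] inj_on_subset[OF bij_betw_imp_inj_on[OF f] e(1)] e(3) by simp
    then show ?thesis
      using e bij_betw_imp_surj_on[OF f] by (auto simp: nsets_def)
  qed
  have sub: "[X]\<^bsup>2\<^esup> \<subseteq> [{..<N}]\<^bsup>2\<^esup>" using X'(1) by (auto simp: nsets_def)
  show ?thesis
    unfolding contains_copy_def colour_subgraph_def complete_graph_def
    using f edge sub mono X'(1)
    by (intro exI[of _ f]) (auto simp: bij_betw_def)
qed

lemma ramsey_arrows_ramsey_number: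
  assumes "simple_graph G" "simple_graph H"
  shows "ramsey_arrows (ramsey_number G H) G H"
proof -
  obtain N :: nat where N: "partn_lst {..<N} [card (verts G), card (verts H)] 2"
    using ramsey_full by blast
  have "ramsey_arrows N G H"
    unfolding ramsey_arrows_def
  proof
    fix c :: "nat set \<Rightarrow> colour"
    define g :: "nat set \<Rightarrow> nat" where "g e = (if c e = Red then 0 else 1)" for e
    have "g \<in> [{..<N}]\<^bsup>2\<^esup> \<rightarrow> {..<length [card (verts G), card (verts H)]}"
      by (auto simp: g_def)
    then obtain i where i: "i < 2"
      "monochromatic {..<N} ([card (verts G), card (verts H)] ! i) 2 g i"
      using N unfolding partn_lst_def by (metis One_nat_def Suc_1 length_Cons list.size(3))
    have blue: "c e = Blue" if "c e \<noteq> Red" for e using that by (cases "c e") auto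
    from i(1) consider "i = 0" | "i = 1" by linarith
    then show "contains_copy (colour_subgraph (complete_graph N) c Red) G \<or>
        contains_copy (colour_subgraph (complete_graph N) c Blue) H"
    proof cases
      case 1
      then obtain X where X: "X \<in> [{..<N}]\<^bsup>card (verts G)\<^esup>" "g ` [X]\<^bsup>2\<^esup> \<subseteq> {0}"
        using i(2) by (auto simp: monochromatic_def)
      have "c e = Red" if "e \<in> [X]\<^bsup>2\<^esup>" for e
        using X(2) that by (auto simp: g_def split: if_splits)
      then show ?thesis using contains_copy_of_clique[OF assms(1) X(1)] by blast
    next
      case 2
      then obtain X where X: "X \<in> [{..<N}]\<^bsup>card (verts H)\<^esup>" "g ` [X]\<^bsup>2\<^esup> \<subseteq> {1}"
        using i(2) by (auto simp: monochromatic_def)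
      have "c e = Blue" if "e \<in> [X]\<^bsup>2\<^esup>" for e
        using X(2) that by (intro blue) (force simp: g_def split: if_splits)
      then show ?thesis using contains_copy_of_clique[OF assms(2) X(1)] by blast
    qed
  qed
  then show ?thesis unfolding ramsey_number_def by (rule LeastI)
qed

end

theory Submission
  imports Defs
begin

text \<open>
  Read a colouring of a complete graph as its red graph \<open>G\<close>: a blue \<open>2K\<^sub>m\<close> is a pair of disjoint
  independent sets of size \<open>m\<close> in \<open>G\<close>.

  For the lower bound, \<open>(n - 1)(m - 1) + 1\<close> vertices are split into \<open>m - 1\<close> classes of size
  \<open>n - 1\<close> and one singleton, and exactly the edges inside classes are red. A connected graph on
  \<open>n\<close> vertices does not fit into a class, while every blue \<open>K\<^sub>m\<close> meets all the classes, so that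
  any two of them share the vertex of the singleton
  (\<open>not_ramsey_arrows_connected_two_cliques\<close>).

  The upper bound rests on the leaves of \<open>T\<close>. A forest on \<open>n\<close> vertices can be
  embedded greedily, leaf by leaf, into a graph with at least \<open>n\<close> vertices and all degrees at
  least \<open>n - 1\<close>. A graph \<open>G\<close> with at least \<open>n\<close> vertices and without a copy of \<open>T\<close> therefore has a
  vertex \<open>v\<close> whose closed neighbourhood \<open>N[v]\<close> has at most \<open>n - 1\<close> elements
  (\<open>low_degree_vertex\<close>). Deleting \<open>N[v]\<close> over and over gives Chvatal's theorem: more than
  \<open>(n - 1)(m - 1)\<close> vertices force \<open>T\<close> or an independent set of size \<open>m\<close>
  (\<open>forest_or_independent_set\<close>).

  The upper bound itself is an induction on \<open>m\<close> (\<open>forest_or_two_independent_sets\<close>). Suppose that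
  \<open>G\<close> has at least \<open>(n - 1)(m - 1) + 2\<close> vertices, no copy of \<open>T\<close>, and no two disjoint independent
  sets of size \<open>m\<close>. The induction hypothesis for \<open>G - N[v]\<close> gives disjoint independent sets \<open>A\<close> and \<open>B\<close>
  of size \<open>m - 1\<close>, and both can be enlarged by \<open>v\<close>. If a vertex \<open>w\<close> outside
  \<open>S = A \<union> B \<union> {v}\<close> had no neighbour in \<open>A\<close>, then \<open>A \<union> {w}\<close> and \<open>B \<union> {v}\<close> would be disjoint
  independent sets of size \<open>m\<close>. Hence every vertex outside \<open>S\<close> has a neighbour in \<open>A\<close>, and
  likewise one in \<open>B\<close>. Now \<open>G - S\<close> has at least \<open>(n - 3)(m - 1) + 1\<close> vertices, which is
  what Chvatal's theorem asks for a forest on \<open>n - 2\<close> vertices. An independent set of size \<open>m\<close>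
  in \<open>G - S\<close> would be disjoint from \<open>A \<union> {v}\<close>, so \<open>G - S\<close> contains \<open>T\<close> minus two
  nonadjacent leaves. One leaf can be attached inside \<open>A\<close> and the other inside \<open>B\<close>, and this
  completes a copy of \<open>T\<close>, a contradiction.
\<close>

section \<open>Embeddings, vertex deletion and independent sets\<close>

definition forest :: "'a ugraph \<Rightarrow> bool" where
  "forest G \<longleftrightarrow> simple_graph G \<and> (\<nexists>p. cycle G p)"

definition embedding :: "('b \<Rightarrow> 'a) \<Rightarrow> 'b ugraph \<Rightarrow> 'a ugraph \<Rightarrow> bool" where
  "embedding f H G \<longleftrightarrow>
    inj_on f (verts H) \<and> f ` verts H \<subseteq> verts G \<and> (\<forall>e\<in>edges H. f ` e \<in> edges G)"

definition delete_verts :: "'a ugraph \<Rightarrow> 'a set \<Rightarrow> 'a ugraph" where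
  "delete_verts G S = \<lparr>verts = verts G - S, edges = {e \<in> edges G. e \<inter> S = {}}\<rparr>"

definition independent :: "'a ugraph \<Rightarrow> 'a set \<Rightarrow> bool" where
  "independent G A \<longleftrightarrow> A \<subseteq> verts G \<and> (\<forall>x\<in>A. \<forall>y\<in>A. {x, y} \<notin> edges G)"

definition neighbours :: "'a ugraph \<Rightarrow> 'a \<Rightarrow> 'a set" where
  "neighbours G v = {x. {v, x} \<in> edges G}"

lemma contains_copy_iff: "contains_copy G H \<longleftrightarrow> (\<exists>f. embedding f H G)"
  by (simp add: contains_copy_def embedding_def)

lemma simple_graph_edgeD:
  assumes "simple_graph G" "{x, y} \<in> edges G"
  shows "x \<in> verts G" "y \<in> verts G" "x \<noteq> y"
proof -
  have "{x, y} \<in> [verts G]\<^bsup>2\<^esup>" using assms unfolding simple_graph_def by blast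
  then show "x \<in> verts G" "y \<in> verts G" "x \<noteq> y"
    by (auto simp: nsets_def card_insert_if split: if_splits)
qed

lemma simple_graph_edgeE:
  assumes "simple_graph G" "e \<in> edges G"
  obtains x y where "e = {x, y}" "x \<noteq> y" "x \<in> verts G" "y \<in> verts G"
proof -
  have e: "e \<in> [verts G]\<^bsup>2\<^esup>" using assms by (auto simp: simple_graph_def)
  then obtain x y where "e = {x, y}" "x \<noteq> y" by (auto simp: nsets_def card_2_iff)
  with e that show thesis by (auto simp: nsets_def)
qed

lemma neighbours_subset: "simple_graph G \<Longrightarrow> neighbours G v \<subseteq> verts G - {v}"
  by (auto simp: neighbours_def dest: simple_graph_edgeD)

lemma simple_graph_delete_verts: "simple_graph G \<Longrightarrow> simple_graph (delete_verts G S)"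
  by (auto simp: simple_graph_def delete_verts_def nsets_def)

lemma verts_delete_verts [simp]: "verts (delete_verts G S) = verts G - S"
  by (simp add: delete_verts_def)

lemma edge_delete_verts:
  "{x, y} \<in> edges (delete_verts G S) \<longleftrightarrow> {x, y} \<in> edges G \<and> x \<notin> S \<and> y \<notin> S"
  by (auto simp: delete_verts_def)

lemma walk_delete_vertsD:
  assumes "walk (delete_verts G S) p"
  shows "walk G p"
proof -
  have "successively (\<lambda>u v. {u, v} \<in> edges G) p"
    using assms unfolding walk_def by (auto simp: edge_delete_verts intro: successively_mono)
  then show ?thesis using assms by (auto simp: walk_def)
qed

lemma forest_delete_verts:
  assumes "forest G"
  shows "forest (delete_verts G S)"
  using assms walk_delete_vertsD[of G S]
  by (auto simp: forest_def simple_graph_delete_verts cycle_def edge_delete_verts)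

lemma independent_delete_verts:
  "independent (delete_verts G S) A \<longleftrightarrow> independent G A \<and> A \<inter> S = {}"
  unfolding independent_def edge_delete_verts by auto

lemma embedding_delete_vertsD: "embedding f H (delete_verts G S) \<Longrightarrow> embedding f H G"
  by (auto simp: embedding_def delete_verts_def)

lemma independent_insert:
  assumes "simple_graph G" "independent G A" "v \<in> verts G" "neighbours G v \<inter> A = {}"
  shows "independent G (insert v A)"
  using assms simple_graph_edgeD(3)[of G v v]
  by (auto simp: independent_def neighbours_def insert_commute)

text \<open>
  A copy of \<open>T - u\<close> becomes a copy of \<open>T\<close> once a fresh vertex \<open>w\<close> is adjacent to the images of all
  neighbours of \<open>u\<close>. This is how leaves are attached below.
\<close>

lemma embedding_extend:
  assumes T: "simple_graph T" and f: "embedding f (delete_verts T {u}) G"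
    and w: "w \<in> verts G" "w \<notin> f ` (verts T - {u})"
    and nb: "\<And>x. x \<in> neighbours T u \<Longrightarrow> f x \<in> neighbours G w"
  shows "embedding (f(u := w)) T G"
proof -
  have inj: "inj_on f (verts T - {u})" and im: "f ` (verts T - {u}) \<subseteq> verts G"
    and E: "\<And>e. e \<in> edges T \<Longrightarrow> u \<notin> e \<Longrightarrow> f ` e \<in> edges G"
    using f by (auto simp: embedding_def delete_verts_def)
  have "inj_on (f(u := w)) (verts T)"
    using inj w(2) by (auto simp: inj_on_def)
  moreover have "(f(u := w)) ` verts T \<subseteq> verts G" using im w(1) by auto
  moreover have "(f(u := w)) ` e \<in> edges G" if e: "e \<in> edges T" for e
  proof (cases "u \<in> e")
    case False
    then have "(f(u := w)) ` e = f ` e" by auto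
    with E[OF e False] show ?thesis by simp
  next
    case True
    then obtain x where x: "e = {u, x}" "x \<noteq> u"
      using simple_graph_edgeE[OF T e] by (metis insertE insert_commute singletonD)
    then have "x \<in> neighbours T u" using e by (simp add: neighbours_def)
    then show ?thesis using nb[of x] x by (simp add: neighbours_def insert_commute)
  qed
  ultimately show ?thesis by (simp add: embedding_def)
qed

section \<open>Leaves of forests\<close>

lemma walk_rev: "walk G (rev p) \<longleftrightarrow> walk G p"
proof -
  have "{v, u} = {u, v}" for u v :: 'a by (rule insert_commute)
  then show ?thesis unfolding walk_def successively_rev set_rev rev_is_Nil_conv by presburger
qed

text \<open>
  An edge from the first vertex of a path to \<open>p ! i\<close> would close the first \<open>i + 1\<close>
  vertices to a cycle; for \<open>i = 1\<close> these are too few, and the edge is the first edge of the path.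
\<close>

lemma no_second_neighbour_on_path:
  assumes ac: "forest G" and p: "walk G p" "distinct p" and i: "i < length p"
    and e: "{hd p, p ! i} \<in> edges G"
  shows "i = 1"
proof (rule ccontr)
  assume "i \<noteq> 1"
  have ne: "p \<noteq> []" using p(1) by (simp add: walk_def)
  have "i \<noteq> 0"
    using e ac ne by (metis forest_def hd_conv_nth simple_graph_edgeD(3))
  define q where "q = take (Suc i) p"
  have "successively (\<lambda>u v. {u, v} \<in> edges G) (q @ drop (Suc i) p)"
    using p(1) by (simp add: q_def walk_def)
  then have "successively (\<lambda>u v. {u, v} \<in> edges G) q"
    by (simp only: successively_append_iff)
  then have "walk G q"
    using p(1) ne set_take_subset[of "Suc i" p] by (auto simp: walk_def q_def)
  moreover have "distinct q" using p(2) by (simp add: q_def)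
  moreover have "length q \<ge> 3" using i \<open>i \<noteq> 0\<close> \<open>i \<noteq> 1\<close> by (simp add: q_def)
  moreover have "last q = p ! i" using i by (simp add: q_def take_Suc_conv_app_nth)
  moreover have "hd q = hd p" using ne by (simp add: q_def)
  ultimately have "cycle G q" using e by (simp add: cycle_def insert_commute)
  then show False using ac by (auto simp: forest_def)
qed

text \<open>
  A neighbour of the first vertex lies on the path, since otherwise the path could be prolonged;
  then it must be the second vertex, because there are no chords.
\<close>

lemma neighbours_hd_longest_path:
  assumes ac: "forest G" and p: "walk G p" "distinct p"
    and longest: "\<And>q. walk G q \<Longrightarrow> distinct q \<Longrightarrow> length q \<le> length p"
  shows "neighbours G (hd p) \<subseteq> {p ! 1}"
proof
  fix x assume x: "x \<in> neighbours G (hd p)"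
  then have e: "{hd p, x} \<in> edges G" by (simp add: neighbours_def)
  have "x \<in> set p"
  proof (rule ccontr)
    assume "x \<notin> set p"
    moreover have "walk G (x # p)"
      using p(1) e ac simple_graph_edgeD(2)[OF _ e]
      by (auto simp: walk_def successively_Cons insert_commute forest_def)
    ultimately have "length (x # p) \<le> length p" using p(2) by (intro longest) auto
    then show False by simp
  qed
  then obtain i where "i < length p" "x = p ! i" by (metis in_set_conv_nth)
  then show "x \<in> {p ! 1}" using no_second_neighbour_on_path[OF ac p] e by auto
qed

lemma longest_path_exists:
  assumes "finite (verts G)" "verts G \<noteq> {}"
  obtains p where "walk G p" "distinct p"
    "\<And>q. walk G q \<Longrightarrow> distinct q \<Longrightarrow> length q \<le> length p"
proof -
  obtain x where "x \<in> verts G" using assms(2) by blast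
  then have x: "walk G [x] \<and> distinct [x]" by (simp add: walk_def)
  have bound: "\<forall>q. walk G q \<and> distinct q \<longrightarrow> length q < Suc (card (verts G))"
    using assms(1) by (metis card_mono distinct_card walk_def less_Suc_eq_le)
  show thesis
    using ex_has_greatest_nat[of "\<lambda>q. walk G q \<and> distinct q", OF x bound] that by blast
qed

lemma forest_leaf:
  assumes "forest F" "verts F \<noteq> {}"
  obtains u p where "u \<in> verts F" "neighbours F u \<subseteq> {p}"
proof -
  have "finite (verts F)" using assms(1) by (simp add: forest_def simple_graph_def)
  then obtain q where q: "walk F q" "distinct q"
    "\<And>r. walk F r \<Longrightarrow> distinct r \<Longrightarrow> length r \<le> length q"
    using longest_path_exists assms(2) by blast
  have "hd q \<in> verts F" using q(1) by (auto simp: walk_def)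
  then show thesis using that neighbours_hd_longest_path[OF assms(1) q] by blast
qed

text \<open>
  Isolated vertices count as leaves here. The ends of a longest path serve as \<open>u\<close> and \<open>v\<close> if it
  has at least three vertices. Otherwise all degrees are at most one, and a vertex \<open>x\<close> cannot be
  adjacent to both of two further vertices.
\<close>

lemma forest_two_leaves:
  assumes ac: "forest F" and three: "card (verts F) \<ge> 3"
  obtains u p v q where "u \<in> verts F" "neighbours F u \<subseteq> {p}"
    "v \<in> verts F" "neighbours F v \<subseteq> {q}" "u \<noteq> v" "{u, v} \<notin> edges F"
proof -
  have fin: "finite (verts F)" using ac by (simp add: forest_def simple_graph_def)
  have "verts F \<noteq> {}" using three by auto
  then obtain r where r: "walk F r" "distinct r"
    and max: "\<And>q. walk F q \<Longrightarrow> distinct q \<Longrightarrow> length q \<le> length r"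
    using longest_path_exists[OF fin] by blast
  show thesis
  proof (cases "length r \<ge> 3")
    case True
    \<comment> \<open>The last vertex is the first one of the reversed path, which is a longest path as well.\<close>
    have ne: "r \<noteq> []" using True by auto
    have r': "walk F (rev r)" "distinct (rev r)"
      "\<And>q. walk F q \<Longrightarrow> distinct q \<Longrightarrow> length q \<le> length (rev r)"
      using r max by (simp_all add: walk_rev)
    have "hd r \<noteq> last r"
      using True r(2) ne by (auto simp: hd_conv_nth last_conv_nth nth_eq_iff_index_eq)
    moreover have "{hd r, last r} \<notin> edges F"
      using no_second_neighbour_on_path[OF ac r, of "length r - 1"] True ne
      by (auto simp: last_conv_nth)
    moreover have "hd r \<in> verts F" "last r \<in> verts F" using r(1) ne by (auto simp: walk_def)
    moreover have "neighbours F (last r) \<subseteq> {rev r ! 1}"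
      using neighbours_hd_longest_path[OF ac r'] by (simp add: hd_rev ne)
    ultimately show thesis
      using that neighbours_hd_longest_path[OF ac r max] by blast
  next
    case False
    have simple: "simple_graph F" using ac by (simp add: forest_def)
    have one: "x = z" if "x \<in> neighbours F y" "z \<in> neighbours F y" for x y z
    proof (rule ccontr)
      assume "x \<noteq> z"
      have E: "{x, y} \<in> edges F" "{y, z} \<in> edges F"
        using that by (simp_all add: neighbours_def insert_commute)
      have "walk F [x, y, z]" "distinct [x, y, z]"
        using E simple_graph_edgeD[OF simple E(1)] simple_graph_edgeD[OF simple E(2)] \<open>x \<noteq> z\<close>
        by (auto simp: walk_def)
      then show False using max[of "[x, y, z]"] False by simp
    qed
    have sub: "\<exists>p. neighbours F y \<subseteq> {p}" for y
      using one[of _ y] by blast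
    obtain X where "X \<subseteq> verts F" "card X = 3"
      using obtain_subset_with_card_n[OF three] by metis
    then obtain x y z where xyz: "{x, y, z} \<subseteq> verts F" "x \<noteq> y" "y \<noteq> z" "x \<noteq> z"
      by (auto simp: card_3_iff)
    have "{x, y} \<notin> edges F \<or> {x, z} \<notin> edges F"
      using one[of y x z] xyz by (auto simp: neighbours_def)
    then show thesis using that sub[of x] sub[of y] sub[of z] xyz by blast
  qed
qed

section \<open>Greedy embedding and Chvatal's theorem\<close>

text \<open>
  Leaves are added one by one: the closed neighbourhood of the image of a leaf's neighbour is too
  large to be used up by the fewer than \<open>card (verts F)\<close> vertices embedded so far. The number of
  vertices of \<open>G\<close> takes care of isolated vertices of \<open>F\<close>. Closed neighbourhoods keep the
  bound free of a subtraction on natural numbers.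
\<close>

lemma embedding_of_forest_min_degree:
  assumes "simple_graph G" "forest F" "card (verts F) \<le> card (verts G)"
    and "\<And>v. v \<in> verts G \<Longrightarrow> card (verts F) \<le> card (insert v (neighbours G v))"
  shows "\<exists>f. embedding f F G"
  using assms
proof (induction "card (verts F)" arbitrary: F)
  case 0
  have F: "simple_graph F" using 0 by (simp add: forest_def)
  then have "verts F = {}" using 0 by (simp add: simple_graph_def)
  moreover have "edges F = {}"
    using simple_graph_edgeE[OF F] calculation by (metis equals0D equals0I)
  ultimately show ?case by (simp add: embedding_def)
next
  case (Suc n)
  have F: "simple_graph F" and finF: "finite (verts F)"
    using Suc.prems by (auto simp: forest_def simple_graph_def)
  have "verts F \<noteq> {}" using Suc.hyps(2) by auto
  then obtain u p where u: "u \<in> verts F" "neighbours F u \<subseteq> {p}"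
    using forest_leaf[OF Suc.prems(2)] by blast
  let ?F = "delete_verts F {u}"
  have card: "card (verts ?F) = n" using u(1) Suc.hyps(2) by simp
  have "\<exists>f. embedding f ?F G"
  proof (rule Suc.hyps(1)[OF card[symmetric] Suc.prems(1) forest_delete_verts[OF Suc.prems(2)]])
    show "card (verts ?F) \<le> card (verts G)" using card Suc by linarith
    show "card (verts ?F) \<le> card (insert v (neighbours G v))" if "v \<in> verts G" for v
      using card Suc.hyps(2) Suc.prems(4)[OF that] by linarith
  qed
  then obtain f where f: "embedding f ?F G" by blast
  let ?I = "f ` (verts F - {u})"
  have I: "finite ?I" "card ?I < card (verts F)" "?I \<subseteq> verts G"
    using f card finF Suc.hyps(2) card_image_le[of "verts F - {u}" f]
    by (auto simp: embedding_def)
  obtain w where w: "w \<in> verts G" "w \<notin> ?I"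
    "\<And>x. x \<in> neighbours F u \<Longrightarrow> f x \<in> neighbours G w"
  proof (cases "neighbours F u = {}")
    case True
    have "\<not> verts G \<subseteq> ?I" using I card_mono[of ?I "verts G"] Suc.prems(3) by linarith
    then show thesis using that True by blast
  next
    case False
    then have p: "neighbours F u = {p}" using u(2) by blast
    then have "p \<in> verts F - {u}" using neighbours_subset[OF F, of u] by blast
    then have "f p \<in> ?I" by blast
    have "\<not> insert (f p) (neighbours G (f p)) \<subseteq> ?I"
      using I card_mono[of ?I "insert (f p) (neighbours G (f p))"] Suc.prems(4)[of "f p"] \<open>f p \<in> ?I\<close>
      by (metis in_mono leD le_less_trans)
    then obtain w where w: "w \<in> neighbours G (f p)" "w \<notin> ?I" using \<open>f p \<in> ?I\<close> by blast
    then have fp: "f p \<in> neighbours G w" by (simp add: neighbours_def insert_commute)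
    show thesis
    proof (rule that)
      show "w \<in> verts G" using w(1) neighbours_subset[OF Suc.prems(1), of "f p"] by blast
      show "f x \<in> neighbours G w" if "x \<in> neighbours F u" for x using that p fp by simp
    qed (rule w(2))
  qed
  show ?case using embedding_extend[OF F f w] by blast
qed

lemma low_degree_vertex:
  assumes "simple_graph G" "forest F" "card (verts F) \<le> card (verts G)"
    and "\<not> (\<exists>f. embedding f F G)"
  obtains v where "v \<in> verts G" "card (insert v (neighbours G v)) \<le> card (verts F) - 1"
proof -
  obtain v where "v \<in> verts G" "card (insert v (neighbours G v)) < card (verts F)"
    using embedding_of_forest_min_degree[OF assms(1-3)] assms(4) not_le by blast
  then show thesis using that by force
qed

lemma card_delete_closed_neighbourhood:
  assumes "simple_graph G" "v \<in> verts G" "card (insert v (neighbours G v)) \<le> k"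
  shows "card (verts G) \<le> card (verts (delete_verts G (insert v (neighbours G v)))) + k"
proof -
  let ?N = "insert v (neighbours G v)"
  have "?N \<subseteq> verts G" "finite (verts G)"
    using assms neighbours_subset[OF assms(1), of v] by (auto simp: simple_graph_def)
  then have "card (verts G - ?N) = card (verts G) - card ?N" "card ?N \<le> card (verts G)"
    using finite_subset by (blast intro: card_Diff_subset card_mono)+
  then show ?thesis
    using assms(3) by simp
qed

text \<open>
  This is the upper bound in Chvatal's theorem on \<open>R(T, K\<^bsub>m+1\<^esub>)\<close>. A vertex of low degree extends
  every independent set that avoids its closed neighbourhood, and deleting that neighbourhood
  costs at most \<open>card (verts F) - 1\<close> vertices, which is what the bound loses when \<open>m\<close> drops by one.
\<close>

lemma forest_or_independent_set:
  assumes "simple_graph G" "forest F" "(card (verts F) - 1) * m < card (verts G)"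
  shows "(\<exists>f. embedding f F G) \<or> (\<exists>A. independent G A \<and> card A = Suc m)"
  using assms(1,3)
proof (induction m arbitrary: G)
  case 0
  then obtain x where x: "x \<in> verts G" by fastforce
  then have "independent G {x}"
    using simple_graph_edgeD(3)[OF 0(1), of x x] by (auto simp: independent_def)
  then show ?case by (intro disjI2 exI[of _ "{x}"]) simp
next
  case (Suc m)
  show ?case
  proof (cases "\<exists>f. embedding f F G")
    case no: False
    have "card (verts F) \<le> card (verts G)" using Suc.prems(2) by simp
    then obtain v where v: "v \<in> verts G"
      "card (insert v (neighbours G v)) \<le> card (verts F) - 1"
      using low_degree_vertex[OF Suc.prems(1) assms(2) _ no] by blast
    let ?S = "insert v (neighbours G v)"
    let ?G = "delete_verts G ?S"
    have "(card (verts F) - 1) * m < card (verts ?G)"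
      using card_delete_closed_neighbourhood[OF Suc.prems(1) v] Suc.prems(2) by simp
    moreover have "\<not> (\<exists>f. embedding f F ?G)" using no embedding_delete_vertsD by blast
    ultimately obtain A where "independent ?G A" and cA: "card A = Suc m"
      using Suc.IH[OF simple_graph_delete_verts[OF Suc.prems(1)]] by blast
    then have A: "independent G A" "A \<inter> ?S = {}" by (simp_all only: independent_delete_verts)
    have "independent G (insert v A)"
      using independent_insert[OF Suc.prems(1) A(1) v(1)] A(2) by blast
    moreover have "card (insert v A) = Suc (Suc m)"
      using cA A(2) card.infinite[of A] by (subst card_insert_disjoint) auto
    ultimately show ?thesis by blast
  qed simp
qed

section \<open>Two disjoint independent sets\<close>

text \<open>
  Since \<open>u\<close> and \<open>v\<close> are nonadjacent, their neighbours are embedded outside \<open>S\<close>, where each image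
  sees both \<open>A\<close> and \<open>B\<close>. Placing \<open>u\<close> in \<open>A\<close> and \<open>v\<close> in \<open>B\<close> avoids a collision even if \<open>u\<close> and
  \<open>v\<close> hang on the same vertex. The sets have to be nonempty in case \<open>u\<close> or \<open>v\<close> is isolated.
\<close>

lemma embedding_attach_two_leaves:
  assumes T: "simple_graph T" and uv: "{u, v} \<notin> edges T"
    and leaf: "neighbours T u \<subseteq> {p}" "neighbours T v \<subseteq> {q}"
    and f: "embedding f (delete_verts T {u, v}) (delete_verts G S)"
    and AB: "A \<subseteq> verts G \<inter> S" "B \<subseteq> verts G \<inter> S" "A \<inter> B = {}" "A \<noteq> {}" "B \<noteq> {}"
    and dom: "\<And>w. w \<in> verts G - S \<Longrightarrow> neighbours G w \<inter> A \<noteq> {} \<and> neighbours G w \<inter> B \<noteq> {}"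
  shows "\<exists>g. embedding g T G"
proof -
  have im: "f ` (verts T - {u, v}) \<subseteq> verts G - S"
    using f by (auto simp: embedding_def)
  have attach: "\<exists>w\<in>C. \<forall>x\<in>neighbours T z. f x \<in> neighbours G w"
    if z: "neighbours T z \<subseteq> {r}" "neighbours T z \<subseteq> verts T - {u, v}"
      and C: "C \<noteq> {}" "\<And>w. w \<in> verts G - S \<Longrightarrow> neighbours G w \<inter> C \<noteq> {}" for z r C
  proof (cases "neighbours T z = {}")
    case True
    then show ?thesis using C(1) by blast
  next
    case False
    then have r: "neighbours T z = {r}" using z(1) by blast
    then have "f r \<in> verts G - S" using z(2) im by blast
    then obtain w where "w \<in> neighbours G (f r)" "w \<in> C" using C(2) by blast
    then show ?thesis using r by (intro bexI[of _ w]) (auto simp: neighbours_def insert_commute)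
  qed
  have nu: "neighbours T u \<subseteq> verts T - {u, v}" and nv: "neighbours T v \<subseteq> verts T - {u, v}"
    using neighbours_subset[OF T, of u] neighbours_subset[OF T, of v] uv
    by (auto simp: neighbours_def insert_commute)
  obtain a where a: "a \<in> A" "\<And>x. x \<in> neighbours T u \<Longrightarrow> f x \<in> neighbours G a"
    using attach[OF leaf(1) nu AB(4)] dom by blast
  obtain b where b: "b \<in> B" "\<And>x. x \<in> neighbours T v \<Longrightarrow> f x \<in> neighbours G b"
    using attach[OF leaf(2) nv AB(5)] dom by blast
  let ?T = "delete_verts T {u}"
  have "delete_verts ?T {v} = delete_verts T {u, v}"
    by (auto simp: delete_verts_def)
  then have f': "embedding f (delete_verts ?T {v}) G"
    using embedding_delete_vertsD[OF f] by simp
  have g: "embedding (f(v := b)) ?T G"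
  proof (rule embedding_extend[OF simple_graph_delete_verts[OF T] f'])
    show "b \<in> verts G" "b \<notin> f ` (verts ?T - {v})" using b(1) AB(2) im by auto
    show "f x \<in> neighbours G b" if "x \<in> neighbours ?T v" for x
      using that b(2) by (auto simp: neighbours_def edge_delete_verts)
  qed
  have "embedding ((f(v := b))(u := a)) T G"
  proof (rule embedding_extend[OF T g])
    show "a \<in> verts G" "a \<notin> (f(v := b)) ` (verts T - {u})" using a(1) b(1) AB im by auto
    show "(f(v := b)) x \<in> neighbours G a" if "x \<in> neighbours T u" for x
      using that a(2) nu by auto
  qed
  then show ?thesis by blast
qed

text \<open>
  The hypothesis on \<open>F\<close> excludes the single edge, which has only one pair of leaves, and these are
  adjacent; for it the bound would be \<open>m + 2\<close>, whereas two disjoint sets of size \<open>m + 1\<close> need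
  \<open>2m + 2\<close> vertices.
\<close>

lemma forest_or_two_independent_sets:
  assumes "simple_graph G" "forest F" "card (verts F) \<ge> 3"
    and "(card (verts F) - 1) * m + 2 \<le> card (verts G)"
  shows "(\<exists>f. embedding f F G) \<or>
    (\<exists>A B. independent G A \<and> independent G B \<and> A \<inter> B = {} \<and> card A = Suc m \<and> card B = Suc m)"
  using assms(1,4)
proof (induction m arbitrary: G)
  case 0
  then obtain X where "X \<subseteq> verts G" "card X = 2"
    using obtain_subset_with_card_n by (metis add_0 mult_0_right)
  then obtain x y where xy: "x \<in> verts G" "y \<in> verts G" "x \<noteq> y" by (auto simp: card_2_iff)
  then have "independent G {x}" "independent G {y}"
    using simple_graph_edgeD(3)[OF 0(1), of x x] simple_graph_edgeD(3)[OF 0(1), of y y]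
    by (auto simp: independent_def)
  then show ?case using xy(3) by (intro disjI2 exI[of _ "{x}"] exI[of _ "{y}"]) simp
next
  case (Suc m)
  note G = Suc.prems(1)
  have finG: "finite (verts G)" using G by (simp add: simple_graph_def)
  show ?case
  proof (rule ccontr)
    assume "\<not> ?thesis"
    then have no: "\<not> (\<exists>f. embedding f F G)"
      and meet: "\<And>A B. independent G A \<Longrightarrow> independent G B \<Longrightarrow> card A = Suc (Suc m) \<Longrightarrow>
        card B = Suc (Suc m) \<Longrightarrow> A \<inter> B \<noteq> {}"
      by blast+
    have "card (verts F) \<le> card (verts G)" using Suc.prems(2) by simp
    then obtain v where v: "v \<in> verts G"
      "card (insert v (neighbours G v)) \<le> card (verts F) - 1"
      using low_degree_vertex[OF G assms(2) _ no] by blast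
    let ?N = "insert v (neighbours G v)"
    let ?G = "delete_verts G ?N"
    have "(card (verts F) - 1) * m + 2 \<le> card (verts ?G)"
      using card_delete_closed_neighbourhood[OF G v] Suc.prems(2) by simp
    moreover have "\<not> (\<exists>f. embedding f F ?G)" using no embedding_delete_vertsD by blast
    ultimately obtain A B where "independent ?G A" "independent ?G B"
      and AB: "A \<inter> B = {}" and card: "card A = Suc m" "card B = Suc m"
      using Suc.IH[OF simple_graph_delete_verts[OF G]] by blast
    then have A: "independent G A" "A \<inter> ?N = {}" and B: "independent G B" "B \<inter> ?N = {}"
      by (simp_all only: independent_delete_verts)
    have fin: "finite A" "finite B" using card card.infinite by force+
    have Av: "independent G (insert v A)" and Bv: "independent G (insert v B)"
      using independent_insert[OF G _ v(1)] A B by blast+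
    have cardv: "card (insert v A) = Suc (Suc m)" "card (insert v B) = Suc (Suc m)"
      using A(2) B(2) fin card by auto
    \<comment> \<open>Every vertex outside \<open>S\<close> sees both \<open>A\<close> and \<open>B\<close>: otherwise it could replace \<open>v\<close> in one
      of the two enlarged sets, and these would become disjoint.\<close>
    define S where "S = insert v (A \<union> B)"
    have sub: "S \<subseteq> verts G" using A(1) B(1) v(1) by (auto simp: S_def independent_def)
    have dom: "neighbours G w \<inter> A \<noteq> {} \<and> neighbours G w \<inter> B \<noteq> {}" if w: "w \<in> verts G - S" for w
    proof (intro conjI notI)
      assume "neighbours G w \<inter> A = {}"
      then have "independent G (insert w A)" using independent_insert[OF G A(1)] w by blast
      moreover have "card (insert w A) = Suc (Suc m)" using w fin card by (simp add: S_def)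
      ultimately show False using meet[OF _ Bv _ cardv(2)] w AB A(2) by (auto simp: S_def)
    next
      assume "neighbours G w \<inter> B = {}"
      then have "independent G (insert w B)" using independent_insert[OF G B(1)] w by blast
      moreover have "card (insert w B) = Suc (Suc m)" using w fin card by (simp add: S_def)
      ultimately show False using meet[OF _ Av _ cardv(1)] w AB B(2) by (auto simp: S_def)
    qed
    obtain x p y q where leaves: "x \<in> verts F" "neighbours F x \<subseteq> {p}"
      "y \<in> verts F" "neighbours F y \<subseteq> {q}" "x \<noteq> y" "{x, y} \<notin> edges F"
      using forest_two_leaves[OF assms(2,3)] by metis
    let ?F = "delete_verts F {x, y}"
    have cF: "card (verts ?F) = card (verts F) - 2" using leaves by (simp add: card_Diff_subset)
    \<comment> \<open>Counting without truncated subtraction: \<open>(k + 2)(m + 1) + 2 - (2m + 3) = k(m + 1) + 1\<close>.\<close>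
    obtain k where k: "card (verts F) = k + 3" using assms(3) by (metis add.commute le_Suc_ex)
    have "card S = 2 * m + 3"
      using AB A(2) B(2) fin card by (simp add: S_def card_Un_disjoint)
    then have "(card (verts ?F) - 1) * Suc m < card (verts (delete_verts G S))"
      using Suc.prems(2) sub finG cF k by (simp add: card_Diff_subset finite_subset algebra_simps)
    then consider f where "embedding f ?F (delete_verts G S)"
      | C where "independent (delete_verts G S) C" "card C = Suc (Suc m)"
      using forest_or_independent_set[OF simple_graph_delete_verts[OF G] forest_delete_verts[OF assms(2)]]
      by blast
    then show False
    proof cases
      case 1
      have "\<exists>g. embedding g F G"
      proof (rule embedding_attach_two_leaves[OF _ leaves(6,2,4) 1, of A B])
        show "simple_graph F" using assms(2) by (simp add: forest_def)
        show "A \<subseteq> verts G \<inter> S" "B \<subseteq> verts G \<inter> S" using sub by (auto simp: S_def)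
        show "A \<noteq> {}" "B \<noteq> {}" using card by auto
      qed (use AB dom in auto)
      then show False using no by blast
    next
      case 2
      then have "independent G C" "C \<inter> insert v A = {}"
        by (auto simp: independent_delete_verts S_def)
      then show False using meet[OF _ Av 2(2) cardv(1)] by blast
    qed
  qed
qed

section \<open>Blue copies of two disjoint cliques\<close>

lemma simple_graph_colour_subgraph_complete:
  "simple_graph (colour_subgraph (complete_graph N) c k)"
  by (auto simp: simple_graph_def colour_subgraph_def complete_graph_def)

lemma edge_colour_subgraph_complete:
  "{x, y} \<in> edges (colour_subgraph (complete_graph N) c k) \<longleftrightarrow>
     x < N \<and> y < N \<and> x \<noteq> y \<and> c {x, y} = k"
  by (auto simp: colour_subgraph_def complete_graph_def nsets_def card_insert_if)

lemma verts_colour_subgraph_complete [simp]: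
  "verts (colour_subgraph (complete_graph N) c k) = {..<N}"
  by (simp add: colour_subgraph_def complete_graph_def)

lemma embedding_iff_simple:
  assumes "simple_graph H"
  shows "embedding f H G \<longleftrightarrow> inj_on f (verts H) \<and> f ` verts H \<subseteq> verts G \<and>
    (\<forall>x y. {x, y} \<in> edges H \<longrightarrow> {f x, f y} \<in> edges G)"
  (is "_ = ?R")
proof
  assume f: "embedding f H G"
  have "{f x, f y} \<in> edges G" if "{x, y} \<in> edges H" for x y
  proof -
    have "f ` {x, y} \<in> edges G" using f that unfolding embedding_def by blast
    then show ?thesis by simp
  qed
  then show ?R using f by (simp add: embedding_def)
next
  assume ?R
  moreover have "f ` e \<in> edges G" if e: "e \<in> edges H" for e
  proof -
    obtain x y where "e = {x, y}" by (rule simple_graph_edgeE[OF assms e])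
    then show ?thesis using e \<open>?R\<close> by simp
  qed
  ultimately show "embedding f H G" by (simp add: embedding_def)
qed

lemma simple_graph_two_cliques:
  "simple_graph (disjoint_union (complete_graph m) (complete_graph m))"
proof -
  have "Inl ` e \<in> [A <+> B]\<^bsup>2\<^esup>" if "e \<in> [A]\<^bsup>2\<^esup>" for e and A B :: "nat set"
    using that by (auto simp: nsets_def card_image)
  moreover have "Inr ` e \<in> [A <+> B]\<^bsup>2\<^esup>" if "e \<in> [B]\<^bsup>2\<^esup>" for e and A B :: "nat set"
    using that by (auto simp: nsets_def card_image)
  ultimately show ?thesis
    by (auto simp: simple_graph_def disjoint_union_def complete_graph_def)
qed

lemma edge_two_cliques:
  "{x, y} \<in> edges (disjoint_union (complete_graph m) (complete_graph m)) \<longleftrightarrow>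
    (\<exists>i<m. \<exists>j<m. i \<noteq> j \<and> (x = Inl i \<and> y = Inl j \<or> x = Inr i \<and> y = Inr j))"
  (is "?L = ?R")
proof
  assume ?L
  then consider e where "{x, y} = Inl ` e" "e \<in> [{..<m}]\<^bsup>2\<^esup>"
    | e where "{x, y} = Inr ` e" "e \<in> [{..<m}]\<^bsup>2\<^esup>"
    by (auto simp: disjoint_union_def complete_graph_def)
  then show ?R
  proof cases
    case 1
    then obtain i j where "e = {i, j}" "i \<noteq> j" "i < m" "j < m"
      by (auto simp: nsets_def card_2_iff)
    with 1(1) show ?thesis by (auto simp: doubleton_eq_iff)
  next
    case 2
    then obtain i j where "e = {i, j}" "i \<noteq> j" "i < m" "j < m"
      by (auto simp: nsets_def card_2_iff)
    with 2(1) show ?thesis by (auto simp: doubleton_eq_iff)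
  qed
next
  assume ?R
  then obtain i j where ij: "i < m" "j < m" "i \<noteq> j"
    "x = Inl i \<and> y = Inl j \<or> x = Inr i \<and> y = Inr j" by blast
  then have "{i, j} \<in> [{..<m}]\<^bsup>2\<^esup>" by (auto simp: nsets_def)
  moreover have "{x, y} = Inl ` {i, j} \<or> {x, y} = Inr ` {i, j}" using ij(4) by auto
  ultimately show ?L unfolding disjoint_union_def complete_graph_def ugraph.simps by blast
qed

lemma verts_two_cliques:
  "verts (disjoint_union (complete_graph m) (complete_graph m)) = {..<m} <+> {..<m}"
  by (simp add: disjoint_union_def complete_graph_def)

lemma blue_two_cliques_iff:
  "contains_copy (colour_subgraph (complete_graph N) c Blue)
     (disjoint_union (complete_graph m) (complete_graph m)) \<longleftrightarrow>
   (\<exists>A B. independent (colour_subgraph (complete_graph N) c Red) A \<and>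
     independent (colour_subgraph (complete_graph N) c Red) B \<and>
     A \<inter> B = {} \<and> card A = m \<and> card B = m)"
  (is "contains_copy ?B ?K \<longleftrightarrow> ?R")
proof
  let ?G = "colour_subgraph (complete_graph N) c Red"
  have ind: "independent ?G A \<longleftrightarrow>
    A \<subseteq> {..<N} \<and> (\<forall>x\<in>A. \<forall>y\<in>A. x \<noteq> y \<longrightarrow> c {x, y} = Blue)" for A
  proof -
    have "c e = Blue \<longleftrightarrow> c e \<noteq> Red" for e by (cases "c e") auto
    then show ?thesis
      unfolding independent_def edge_colour_subgraph_complete verts_colour_subgraph_complete by blast
  qed
  have independent_image: "independent ?G (h ` {..<m})"
    if h: "h ` {..<m} \<subseteq> {..<N}"
      "\<And>i j. i < m \<Longrightarrow> j < m \<Longrightarrow> i \<noteq> j \<Longrightarrow> c {h i, h j} = Blue" for h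
    unfolding ind
  proof (intro conjI ballI impI)
    fix x y assume "x \<in> h ` {..<m}" "y \<in> h ` {..<m}" and "x \<noteq> y"
    then obtain i j where "i < m" "j < m" "x = h i" "y = h j" by blast
    then show "c {x, y} = Blue" using h(2)[of i j] \<open>x \<noteq> y\<close> by blast
  qed (rule h(1))
  show ?R if copy: "contains_copy ?B ?K"
  proof -
    obtain f where f: "embedding f ?K ?B"
      using copy unfolding contains_copy_iff by (elim exE)
    have inj: "inj_on f ({..<m} <+> {..<m})" and im: "f ` ({..<m} <+> {..<m}) \<subseteq> {..<N}"
      using f by (simp_all add: embedding_def verts_two_cliques)
    have E: "{f x, f y} \<in> edges ?B" if "{x, y} \<in> edges ?K" for x y
      using f that by (simp add: embedding_iff_simple[OF simple_graph_two_cliques])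
    let ?A = "(\<lambda>i. f (Inl i)) ` {..<m}" and ?C = "(\<lambda>i. f (Inr i)) ` {..<m}"
    have "inj_on (\<lambda>i. f (Inl i)) {..<m}" "inj_on (\<lambda>i. f (Inr i)) {..<m}"
      using inj by (auto simp: inj_on_def)
    then have card: "card ?A = m" "card ?C = m" by (simp_all add: card_image)
    have disj: "?A \<inter> ?C = {}" using inj by (auto simp: inj_on_def)
    have "c {f (Inl i), f (Inl j)} = Blue" "c {f (Inr i), f (Inr j)} = Blue"
      if "i < m" "j < m" "i \<noteq> j" for i j
      using E[of "Inl i" "Inl j"] E[of "Inr i" "Inr j"] that
      by (auto simp: edge_two_cliques edge_colour_subgraph_complete)
    moreover have "?A \<subseteq> {..<N}" "?C \<subseteq> {..<N}" using im by auto
    ultimately have "independent ?G ?A" "independent ?G ?C"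
      by (simp_all add: independent_image)
    with card disj show ?thesis by blast
  qed
  show "contains_copy ?B ?K" if sets: ?R
  proof -
    obtain A B where indep: "independent ?G A" "independent ?G B"
      and AB: "A \<inter> B = {}" "card A = m" "card B = m"
      using sets by blast
    have sub: "A \<subseteq> {..<N}" "B \<subseteq> {..<N}" using indep by (simp_all add: ind)
    have A: "c {x, y} = Blue" if "x \<in> A" "y \<in> A" "x \<noteq> y" for x y
      using that indep(1) by (simp add: ind)
    have B: "c {x, y} = Blue" if "x \<in> B" "y \<in> B" "x \<noteq> y" for x y
      using that indep(2) by (simp add: ind)
    have fin: "finite A" "finite B" using sub finite_subset by blast+
    obtain g where g: "bij_betw g {..<m} A"
      using AB fin finite_same_card_bij[of "{..<m}" A] by auto
    obtain h where h: "bij_betw h {..<m} B"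
      using AB fin finite_same_card_bij[of "{..<m}" B] by auto
    have gh: "g i \<in> A" "h i \<in> B" if "i < m" for i
      using that g h by (auto simp: bij_betw_def)
    have ghN: "g i < N" "h i < N" if "i < m" for i
      using gh[OF that] sub by auto
    have inj: "g i = g j \<longleftrightarrow> i = j" "h i = h j \<longleftrightarrow> i = j" if "i < m" "j < m" for i j
      using that g h by (auto simp: bij_betw_def inj_on_def)
    have ne: "g i \<noteq> h j" "h j \<noteq> g i" if "i < m" "j < m" for i j
      using gh that AB(1) by (metis disjoint_iff)+
    let ?f = "case_sum g h"
    have "embedding ?f ?K ?B"
      unfolding embedding_iff_simple[OF simple_graph_two_cliques] verts_two_cliques
        verts_colour_subgraph_complete
    proof (intro conjI allI impI)
      show "inj_on ?f ({..<m} <+> {..<m})"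
        using inj ne by (auto simp: inj_on_def)
      show "?f ` ({..<m} <+> {..<m}) \<subseteq> {..<N}"
        using ghN by auto
      fix x y assume "{x, y} \<in> edges ?K"
      then obtain i j where ij: "i < m" "j < m" "i \<noteq> j"
        and "x = Inl i \<and> y = Inl j \<or> x = Inr i \<and> y = Inr j"
        unfolding edge_two_cliques by blast
      then consider "?f x = g i" "?f y = g j" | "?f x = h i" "?f y = h j" by auto
      then show "{?f x, ?f y} \<in> edges ?B"
      proof cases
        case 1
        then show ?thesis using A[of "g i" "g j"] gh ghN inj ij
          by (simp add: edge_colour_subgraph_complete)
      next
        case 2
        then show ?thesis using B[of "h i" "h j"] gh ghN inj ij
          by (simp add: edge_colour_subgraph_complete)
      qed
    qed
    then show ?thesis by (auto simp: contains_copy_iff)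
  qed
qed

lemma ramsey_arrows_forest_two_cliques:
  assumes "forest F" "card (verts F) \<ge> 3"
  shows "ramsey_arrows ((card (verts F) - 1) * m + 2) F
    (disjoint_union (complete_graph (Suc m)) (complete_graph (Suc m)))"
  unfolding ramsey_arrows_def
proof
  fix c
  let ?N = "(card (verts F) - 1) * m + 2"
  have "(\<exists>f. embedding f F (colour_subgraph (complete_graph ?N) c Red)) \<or>
    (\<exists>A B. independent (colour_subgraph (complete_graph ?N) c Red) A \<and>
      independent (colour_subgraph (complete_graph ?N) c Red) B \<and>
      A \<inter> B = {} \<and> card A = Suc m \<and> card B = Suc m)"
    by (rule forest_or_two_independent_sets)
      (use assms in \<open>simp_all add: simple_graph_colour_subgraph_complete\<close>)
  then show "contains_copy (colour_subgraph (complete_graph ?N) c Red) F \<or>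
    contains_copy (colour_subgraph (complete_graph ?N) c Blue)
      (disjoint_union (complete_graph (Suc m)) (complete_graph (Suc m)))"
    unfolding blue_two_cliques_iff unfolding contains_copy_iff .
qed

section \<open>The extremal colouring\<close>

lemma connected_graph_constant:
  assumes "connected_graph G" and E: "\<And>u v. {u, v} \<in> edges G \<Longrightarrow> \<phi> u = \<phi> v"
    and "u \<in> verts G" "v \<in> verts G"
  shows "\<phi> u = \<phi> v"
proof -
  obtain p where p: "walk G p" "hd p = u" "last p = v"
    using assms(1,3,4) unfolding connected_graph_def by blast
  have "\<phi> (hd q) = \<phi> (last q)" if "q \<noteq> []" "successively (\<lambda>u v. {u, v} \<in> edges G) q" for q
    using that by (induction q) (auto simp: successively_Cons dest: E)
  then show ?thesis using p by (auto simp: walk_def)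
qed

text \<open>
  Colour an edge red if its ends have the same quotient by \<open>k\<close>. Among the numbers up to \<open>k m\<close>
  the quotients \<open>0, \<dots>, m - 1\<close> are taken \<open>k\<close> times each and the quotient \<open>m\<close> only by \<open>k m\<close>. A red
  connected subgraph stays in one class, and a blue clique on \<open>m + 1\<close> vertices uses all the
  quotients, hence contains the vertex \<open>k m\<close>.
\<close>

lemma not_ramsey_arrows_connected_two_cliques:
  assumes T: "simple_graph T" "connected_graph T" and k: "card (verts T) = Suc k" "k > 0"
    and N: "N \<le> k * m + 1"
  shows "\<not> ramsey_arrows N T
    (disjoint_union (complete_graph (Suc m)) (complete_graph (Suc m)))"
proof
  define c where "c e = (if \<exists>q. \<forall>x\<in>e. x div k = q then Red else Blue)" for e
  have c: "c {x, y} = Red \<longleftrightarrow> x div k = y div k" for x y by (auto simp: c_def)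
  let ?R = "colour_subgraph (complete_graph N) c Red"
  assume "ramsey_arrows N T (disjoint_union (complete_graph (Suc m)) (complete_graph (Suc m)))"
  then consider f where "embedding f T ?R"
    | A B where "independent ?R A" "independent ?R B" "A \<inter> B = {}"
      "card A = Suc m" "card B = Suc m"
    unfolding ramsey_arrows_def blue_two_cliques_iff unfolding contains_copy_iff by blast
  then show False
  proof cases
    case 1
    then have inj: "inj_on f (verts T)" by (simp add: embedding_def)
    have E: "f x div k = f y div k" if "{x, y} \<in> edges T" for x y
      using 1 that by (simp add: embedding_iff_simple[OF T(1)] edge_colour_subgraph_complete c)
    obtain t where t: "t \<in> verts T" using T(2) by (auto simp: connected_graph_def)
    define q where "q = f t div k"
    have "f x div k = q" if "x \<in> verts T" for x
      using connected_graph_constant[OF T(2), of "\<lambda>x. f x div k"] E that t by (metis q_def)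
    then have "q * k \<le> f x \<and> f x < q * k + k" if "x \<in> verts T" for x
      using that k(2) dividend_less_div_times[of k "f x"] div_times_less_eq_dividend[of "f x" k]
      by (simp add: add.commute)
    then have "f ` verts T \<subseteq> {q * k..<q * k + k}" by auto
    then have "card (f ` verts T) \<le> card {q * k..<q * k + k}" by (intro card_mono) auto
    then show False using inj k(1) by (simp add: card_image)
  next
    case 2
    have last: "k * m \<in> C" if C: "independent ?R C" "card C = Suc m" for C
    proof -
      have sub: "C \<subseteq> {..<N}" using C(1) by (simp add: independent_def)
      have inj: "inj_on (\<lambda>x. x div k) C"
        using C(1) sub unfolding inj_on_def independent_def edge_colour_subgraph_complete c by blast
      have "(\<lambda>x. x div k) ` C \<subseteq> {..m}"
      proof
        fix j assume "j \<in> (\<lambda>x. x div k) ` C"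
        then obtain x where x: "x \<in> C" "j = x div k" by blast
        then have "x \<le> k * m" using sub N by auto
        then show "j \<in> {..m}" using x(2) div_le_mono[of x "k * m" k] k(2) by simp
      qed
      moreover have "card ((\<lambda>x. x div k) ` C) = card {..m}"
        using inj C(2) by (simp add: card_image)
      ultimately have "(\<lambda>x. x div k) ` C = {..m}" by (simp add: card_subset_eq)
      then obtain x where x: "x \<in> C" "x div k = m" by (metis atMost_iff imageE le_refl)
      have "x \<le> k * m" using x(1) sub N by auto
      moreover have "k * m \<le> x" using x(2) by (metis div_times_less_eq_dividend mult.commute)
      ultimately show ?thesis using x(1) by simp
    qed
    show False using last 2 by blast
  qed
qed

section \<open>The Ramsey number\<close>

theorem theorem1p2:
  fixes n m :: nat and T :: "'a ugraph"
  assumes "n \<ge> 3" and "m \<ge> 2"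
    and "tree T" and "card (verts T) = n"
  shows "ramsey_number T (disjoint_union (complete_graph m) (complete_graph m))
           = (n - 1) * (m - 1) + 2"
proof -
  obtain k where k: "m = Suc k" using assms(2) by (cases m) auto
  have T: "forest T" "simple_graph T" "connected_graph T"
    using assms(3) by (auto simp: tree_def forest_def)
  show ?thesis
    unfolding ramsey_number_def
  proof (rule Least_equality)
    show "ramsey_arrows ((n - 1) * (m - 1) + 2) T
        (disjoint_union (complete_graph m) (complete_graph m))"
      using ramsey_arrows_forest_two_cliques[OF T(1), of k] assms k by simp
    show "(n - 1) * (m - 1) + 2 \<le> N"
      if "ramsey_arrows N T (disjoint_union (complete_graph m) (complete_graph m))" for N
      using not_ramsey_arrows_connected_two_cliques[OF T(2,3), of "n - 1" N k] that assms k
      by (cases "(n - 1) * (m - 1) + 2 \<le> N") auto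
  qed
qed

end
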